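(* Let $X$ be a set and $\tau$ a topology on $X$. Let $\mathcal R(X,\tau)$ denote the set of all non-trivial and semi-transitive bi-relations $(R_H,R_S)$ on $X$ such that $\tau(R_H,R_S)\subseteq\tau$, where $\tau(R_H,R_S)$ is the coarsest topology on $X$ containing all (upper and lower) sections of $P_S$ and the complements of all (upper and lower) sections of $R_H$. Then the following are equivalent: (a) the space $(X,\tau)$ is connected; (b) for every relation $R$ on $X$, if $(R,R)\in\mathcal R(X,\tau)$, then $R$ is complete and transitive; (c) for every bi-relation $(R_H,R_S)$ on $X$, if $(R_H,R_S)\in\mathcal R(X,\tau)$, then $R_S$ is complete and transitive.
   Context: A (binary) relation $R$ on a set $X$ is a subset of $X\times X$. Notation: $R^{-1}=\{(x,y) : (y,x)\in R\}$; upper and lower sections at $x$: $R(x)=\{y : (x,y)\in R\}$ and $R^{-1}(x)=\{y : (y,x)\in R\}$; symmetric part $I=R\cap R^{-1}$; asymmetric part $P=R\setminus R^{-1}$. For relations $R,R'$ on $X$, the composition $R\circ R'$ is defined by: $(y,x)\in R\circ R'$ iff $R^{-1}(x)\cap R'(y)\neq\emptyset$ (i.e. there is $z$ with $(y,z)\in R'$ and $(z,x)\in R$). A relation $R$ is semi-transitive if $I\circ P\subseteq P$ and $P\circ I\subseteq P$; transitive if $R\circ R\subseteq R$; complete if $R\cup R^{-1}=X\times X$. A bi-relation on $X$ is a pair $(R_H,R_S)$ of relations on $X$ such that $R_H\subseteq R_S$ and $P_S\subseteq P_H$, where $I_H,P_H$ (resp. $I_S,P_S$) denote the symmetric and asymmetric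 parts of $R_H$ (resp. $R_S$). The bi-relation is non-trivial if $P_S\neq\emptyset$. It is semi-transitive if (i) $R_H$ is semi-transitive; (ii) $I_S\circ R_H\subseteq R_S$ and $R_H\circ I_S\subseteq R_S$; (iii) $P_H\cap(P_S\circ I_S)\subseteq P_S$ and $P_H\cap(I_S\circ P_S)\subseteq P_S$. A topological space is connected if it is not the union of two non-empty, disjoint open sets (so the empty space counts as connected). *)

theory Defs
  imports "HOL-Analysis.Analysis"
begin

definition sym_part :: "'a rel \<Rightarrow> 'a rel" where
  "sym_part R = R \<inter> R\<inverse>"

definition asym_part :: "'a rel \<Rightarrow> 'a rel" where
  "asym_part R = R - R\<inverse>"

(* The right factor is applied first, i.e. the opposite order of the library's O. *)
definition rel_compose :: "'a rel \<Rightarrow> 'a rel \<Rightarrow> 'a rel"  (infixl "\<circ>\<^sub>r" 75) where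
  "R \<circ>\<^sub>r R' = {(y, x). R\<inverse> `` {x} \<inter> R' `` {y} \<noteq> {}}"

lemma rel_compose_eq: "R \<circ>\<^sub>r R' = R' O R"
  by (auto simp: rel_compose_def)

definition semi_transitive :: "'a rel \<Rightarrow> bool" where
  "semi_transitive R \<longleftrightarrow>
     sym_part R \<circ>\<^sub>r asym_part R \<subseteq> asym_part R \<and>
     asym_part R \<circ>\<^sub>r sym_part R \<subseteq> asym_part R"

(* Includes the diagonal, unlike the library's total_on. *)
definition complete_rel_on :: "'a set \<Rightarrow> 'a rel \<Rightarrow> bool" where
  "complete_rel_on X R \<longleftrightarrow> R \<union> R\<inverse> = X \<times> X"

definition bi_relation :: "'a set \<Rightarrow> 'a rel \<Rightarrow> 'a rel \<Rightarrow> bool" where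
  "bi_relation X RH RS \<longleftrightarrow>
     RH \<subseteq> X \<times> X \<and> RS \<subseteq> X \<times> X \<and> RH \<subseteq> RS \<and> asym_part RS \<subseteq> asym_part RH"

definition nontrivial_bi_relation :: "'a rel \<Rightarrow> 'a rel \<Rightarrow> bool" where
  "nontrivial_bi_relation RH RS \<longleftrightarrow> asym_part RS \<noteq> {}"

definition semi_transitive_bi_relation :: "'a rel \<Rightarrow> 'a rel \<Rightarrow> bool" where
  "semi_transitive_bi_relation RH RS \<longleftrightarrow>
     semi_transitive RH \<and>
     sym_part RS \<circ>\<^sub>r RH \<subseteq> RS \<and> RH \<circ>\<^sub>r sym_part RS \<subseteq> RS \<and>
     asym_part RH \<inter> (asym_part RS \<circ>\<^sub>r sym_part RS) \<subseteq> asym_part RS \<and>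
     asym_part RH \<inter> (sym_part RS \<circ>\<^sub>r asym_part RS) \<subseteq> asym_part RS"

definition bi_relation_subbase :: "'a set \<Rightarrow> 'a rel \<Rightarrow> 'a rel \<Rightarrow> 'a set set" where
  "bi_relation_subbase X RH RS =
     (\<Union>x\<in>X. {asym_part RS `` {x}, (asym_part RS)\<inverse> `` {x}, X - RH `` {x}, X - RH\<inverse> `` {x}})"

(* The carrier of topology_generated_by S is the union of S, so X is inserted explicitly
   to obtain a topology on all of X. *)
definition bi_relation_topology :: "'a set \<Rightarrow> 'a rel \<Rightarrow> 'a rel \<Rightarrow> 'a topology" where
  "bi_relation_topology X RH RS = topology_generated_by (insert X (bi_relation_subbase X RH RS))"

lemma topspace_bi_relation_topology:
  assumes "bi_relation X RH RS"
  shows "topspace (bi_relation_topology X RH RS) = X"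
  using assms
  by (auto simp: bi_relation_topology_def bi_relation_subbase_def bi_relation_def asym_part_def)

definition admissible_bi_relations :: "'a set \<Rightarrow> 'a topology \<Rightarrow> ('a rel \<times> 'a rel) set" where
  "admissible_bi_relations X T =
     {(RH, RS). bi_relation X RH RS \<and> nontrivial_bi_relation RH RS \<and>
        semi_transitive_bi_relation RH RS \<and>
        (\<forall>U. openin (bi_relation_topology X RH RS) U \<longrightarrow> openin T U)}"

end

theory Submission
  imports Defs
begin

text \<open>
  In a connected space, the open set \<open>P\<^sub>S(x) \<union> P\<^sub>S\<inverse>(y)\<close> coincides with the closed set
  \<open>R\<^sub>H(x) \<union> R\<^sub>H\<inverse>(y)\<close> whenever \<open>(x, y) \<in> P\<^sub>S\<close>, so it is everything: \<open>P\<^sub>S\<close> is negatively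
  transitive. If \<open>z\<close>, \<open>w\<close> were \<open>R\<^sub>S\<close>-incomparable and, up to passing to
  converses, \<open>P\<^sub>S\<inverse>(z) \<noteq> {}\<close>, then
  \<open>P\<^sub>S\<inverse>(z) = P\<^sub>S\<inverse>(w)\<close> would coincide with \<open>R\<^sub>H\<inverse>(z) \<inter> R\<^sub>H\<inverse>(w)\<close>, hence again be everything,
  contradicting irreflexivity. So \<open>R\<^sub>S\<close> is complete and negative transitivity of \<open>P\<^sub>S\<close> becomes
  transitivity of \<open>R\<^sub>S\<close>. Conversely, a separation \<open>X = A \<union> B\<close> yields the admissible but
  irreflexive relation \<open>A \<times> B\<close>.
\<close>

lemma asym_part_converse: "asym_part (R\<inverse>) = (asym_part R)\<inverse>"
  by (auto simp: asym_part_def)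

lemma sym_part_converse: "sym_part (R\<inverse>) = sym_part R"
  by (auto simp: sym_part_def)

lemma sym_partI:
  assumes "(x, y) \<in> R" "(x, y) \<notin> asym_part R"
  shows "(x, y) \<in> sym_part R" "(y, x) \<in> sym_part R"
  using assms by (auto simp: asym_part_def sym_part_def)

text \<open>A generated topology lies inside \<open>T\<close> as soon as its subbase does, and
  \<open>X\<close> is open as the whole space. Openness of the complements turns into closedness of
  the \<open>RH\<close> sections, which lie in \<open>X\<close>.\<close>

lemma admissible_iff:
  assumes "topspace T = X"
  shows "(RH, RS) \<in> admissible_bi_relations X T \<longleftrightarrow>
     bi_relation X RH RS \<and> nontrivial_bi_relation RH RS \<and> semi_transitive_bi_relation RH RS \<and>
     (\<forall>x\<in>X. openin T (asym_part RS `` {x}) \<and> openin T ((asym_part RS)\<inverse> `` {x}) \<and>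
            closedin T (RH `` {x}) \<and> closedin T (RH\<inverse> `` {x}))"
    (is "_ \<longleftrightarrow> ?B \<and> _ \<and> _ \<and> ?S")
proof -
  have "(\<forall>U. openin (bi_relation_topology X RH RS) U \<longrightarrow> openin T U) \<longleftrightarrow> ?S" if B: ?B
  proof -
    have "(\<forall>U. openin (bi_relation_topology X RH RS) U \<longrightarrow> openin T U) \<longleftrightarrow>
          (\<forall>U\<in>insert X (bi_relation_subbase X RH RS). openin T U)"
      unfolding bi_relation_topology_def
      by (blast intro: topology_generated_by_Basis generate_topology_on_coarsest
          istopology_openin dest: openin_topology_generated_by)
    also have "\<dots> \<longleftrightarrow> ?S"
      using assms B openin_topspace[of T]
      by (auto simp: bi_relation_subbase_def bi_relation_def closedin_def)
    finally show ?thesis .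
  qed
  then show ?thesis
    by (auto simp: admissible_bi_relations_def)
qed

text \<open>Duality: passing to converses swaps upper with lower sections and the two inclusions
  within each pair of semi-transitivity conditions.\<close>

lemma admissible_converse:
  assumes "topspace T = X" "(RH, RS) \<in> admissible_bi_relations X T"
  shows "(RH\<inverse>, RS\<inverse>) \<in> admissible_bi_relations X T"
proof -
  have flip: "P\<inverse> O sym_part R \<subseteq> Q\<inverse> \<longleftrightarrow> sym_part R O P \<subseteq> Q"
    "sym_part R O P\<inverse> \<subseteq> Q\<inverse> \<longleftrightarrow> P O sym_part R \<subseteq> Q"
    "K\<inverse> \<inter> (P\<inverse> O sym_part R) \<subseteq> Q\<inverse> \<longleftrightarrow> K \<inter> (sym_part R O P) \<subseteq> Q"
    "K\<inverse> \<inter> (sym_part R O P\<inverse>) \<subseteq> Q\<inverse> \<longleftrightarrow> K \<inter> (P O sym_part R) \<subseteq> Q" for K P Q R :: "'a rel"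
  proof -
    have "P\<inverse> O sym_part R = (sym_part R O P)\<inverse>" "sym_part R O P\<inverse> = (P O sym_part R)\<inverse>"
      by (auto simp: sym_part_def)
    then show "P\<inverse> O sym_part R \<subseteq> Q\<inverse> \<longleftrightarrow> sym_part R O P \<subseteq> Q"
      "sym_part R O P\<inverse> \<subseteq> Q\<inverse> \<longleftrightarrow> P O sym_part R \<subseteq> Q"
      "K\<inverse> \<inter> (P\<inverse> O sym_part R) \<subseteq> Q\<inverse> \<longleftrightarrow> K \<inter> (sym_part R O P) \<subseteq> Q"
      "K\<inverse> \<inter> (sym_part R O P\<inverse>) \<subseteq> Q\<inverse> \<longleftrightarrow> K \<inter> (P O sym_part R) \<subseteq> Q"
      by (simp_all flip: converse_Int)
  qed
  have "bi_relation X (RH\<inverse>) (RS\<inverse>) \<longleftrightarrow> bi_relation X RH RS"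
    by (auto simp: bi_relation_def asym_part_converse)
  moreover have "semi_transitive_bi_relation (RH\<inverse>) (RS\<inverse>) \<longleftrightarrow> semi_transitive_bi_relation RH RS"
    unfolding semi_transitive_bi_relation_def semi_transitive_def rel_compose_eq
      asym_part_converse sym_part_converse flip
    by argo
  ultimately show ?thesis
    using assms(2)
    by (auto simp: admissible_iff[OF assms(1)] nontrivial_bi_relation_def asym_part_converse)
qed

text \<open>Purely order-theoretic. If both alternatives fail, x and z are
  \<open>RS\<close>-indifferent, and each of the two ways \<open>RH\<close> can relate x to z forces
  one of the alternatives after all.\<close>

lemma asym_part_split:
  assumes "topspace T = X" "(RH, RS) \<in> admissible_bi_relations X T"
    and xy: "(x, y) \<in> asym_part RS" and xz: "(x, z) \<in> RH"
  shows "(x, z) \<in> asym_part RS \<or> (z, y) \<in> asym_part RS"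
proof (rule ccontr)
  assume neg: "\<not> ?thesis"
  note [simp] = admissible_iff[OF assms(1)] bi_relation_def semi_transitive_bi_relation_def
    semi_transitive_def rel_compose_eq
  have le: "RH \<subseteq> RS" "asym_part RS \<subseteq> asym_part RH"
    using assms(2) by auto
  have semi: "sym_part RH O asym_part RH \<subseteq> asym_part RH" "sym_part RS O RH \<subseteq> RS"
    "asym_part RH \<inter> (sym_part RS O asym_part RS) \<subseteq> asym_part RS"
    "asym_part RH \<inter> (asym_part RS O sym_part RS) \<subseteq> asym_part RS"
    using assms(2) by auto
  have xy': "(x, y) \<in> asym_part RH" "(x, y) \<in> RH"
    using xy le by (auto simp: asym_part_def)
  have zx: "(z, x) \<in> sym_part RS"
    using neg xz le by (intro sym_partI(2)) auto
  consider "(x, z) \<in> asym_part RH" | "(z, x) \<in> sym_part RH"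
    using sym_partI(2)[OF xz] by blast
  then show False
  proof cases
    case 1
    \<comment> \<open>So y and z are \<open>RS\<close>-indifferent as well, and x being strictly
      above y then lifts the strict \<open>RH\<close> pair (x, z) to \<open>RS\<close>.\<close>
    have "(z, y) \<in> RS"
      using zx xy' semi by blast
    then have "(y, z) \<in> sym_part RS"
      using neg by (intro sym_partI(2)) auto
    then show False
      using 1 neg xy semi by blast
  next
    case 2
    \<comment> \<open>The roles change: this strict \<open>RH\<close> pair lifts to
      \<open>RS\<close> along z indifferent to x, x strictly above y.\<close>
    then have "(z, y) \<in> asym_part RH"
      using xy' semi by blast
    then show False
      using neg xy zx semi by blast
  qed
qed

lemma asym_part_negatively_transitive:
  assumes T: "topspace T = X" and conn: "connected_space T"
    and adm: "(RH, RS) \<in> admissible_bi_relations X T"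
    and xy: "(x, y) \<in> asym_part RS" and z: "z \<in> X"
  shows "(x, z) \<in> asym_part RS \<or> (z, y) \<in> asym_part RS"
proof -
  let ?U = "asym_part RS `` {x} \<union> (asym_part RS)\<inverse> `` {y}"
  let ?C = "RH `` {x} \<union> RH\<inverse> `` {y}"
  have B: "bi_relation X RH RS"
    using adm by (simp add: admissible_iff[OF T])
  then have X: "x \<in> X" "y \<in> X" and PR: "asym_part RS \<subseteq> RH"
    using xy by (auto simp: bi_relation_def asym_part_def)
  \<comment> \<open>The section at x is covered by the split itself, the one at y by its
    dual.\<close>
  have "?C \<subseteq> ?U"
    using asym_part_split[OF T adm xy]
      asym_part_split[OF T admissible_converse[OF T adm], of y x] xy
    by (auto simp: asym_part_converse)
  then have "?U = ?C"
    using PR by blast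
  moreover have "openin T ?U" "closedin T ?C"
    using adm X by (auto simp: admissible_iff[OF T])
  ultimately have "?U = {} \<or> ?U = X"
    using conn T unfolding connected_space_clopen_in by metis
  then show ?thesis
    using xy z by blast
qed

lemma comparable_if_dominated:
  assumes T: "topspace T = X" and conn: "connected_space T"
    and adm: "(RH, RS) \<in> admissible_bi_relations X T"
    and xz: "(x, z) \<in> asym_part RS" and w: "w \<in> X"
  shows "(z, w) \<in> RS \<or> (w, z) \<in> RS"
proof (rule ccontr)
  assume neg: "\<not> ?thesis"
  let ?U = "(asym_part RS)\<inverse> `` {z}"
  let ?C = "RH\<inverse> `` {z} \<inter> RH\<inverse> `` {w}"
  have B: "bi_relation X RH RS" and semi: "sym_part RS O RH \<subseteq> RS"
    using adm by (auto simp: admissible_iff[OF T] semi_transitive_bi_relation_def rel_compose_eq)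
  then have z: "z \<in> X" and PR: "asym_part RS \<subseteq> RH" "RH \<subseteq> RS" "asym_part RS \<subseteq> RS"
    using xz by (auto simp: bi_relation_def asym_part_def)
  \<comment> \<open>Negative transitivity offers (w, z) as the only other option, which
    incomparability excludes.\<close>
  have "(v, w) \<in> asym_part RS" if "(v, z) \<in> asym_part RS" for v
    using asym_part_negatively_transitive[OF T conn adm that w] neg PR by blast
  then have "?U \<subseteq> ?C"
    using PR by blast
  moreover have "?C \<subseteq> ?U"
  proof
    fix v assume "v \<in> ?C"
    then have v: "(v, z) \<in> RH" "(v, w) \<in> RH"
      by auto
    \<comment> \<open>Indifference of z and v would compose with (v, w) in \<open>RH\<close> to make
      z and w comparable.\<close>
    then have "(z, v) \<notin> sym_part RS"
      using neg semi by blast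
    then show "v \<in> ?U"
      using v PR sym_partI(2)[of v z RS] by blast
  qed
  ultimately have "?U = ?C"
    by blast
  moreover have "openin T ?U" "closedin T ?C"
    using adm z w by (auto simp: admissible_iff[OF T])
  ultimately have "?U = {} \<or> ?U = X"
    using conn T unfolding connected_space_clopen_in by metis
  \<comment> \<open>x lies in \<open>?U\<close>, while z does not by irreflexivity.\<close>
  then show False
    using xz z by (auto simp: asym_part_def)
qed

lemma connected_imp_complete_trans:
  assumes T: "topspace T = X" and conn: "connected_space T"
    and adm: "(RH, RS) \<in> admissible_bi_relations X T"
  shows "complete_rel_on X RS \<and> trans RS"
proof -
  have sub: "RS \<subseteq> X \<times> X"
    using adm by (simp add: admissible_iff[OF T] bi_relation_def)
  obtain x y where xy: "(x, y) \<in> asym_part RS"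
    using adm by (auto simp: admissible_iff[OF T] nontrivial_bi_relation_def)
  \<comment> \<open>Splitting the strict pair (x, y) at z puts z below x or above y; the second case
    is the first one for the converses.\<close>
  have comp: "(z, w) \<in> RS \<or> (w, z) \<in> RS" if "z \<in> X" "w \<in> X" for z w
    using asym_part_negatively_transitive[OF T conn adm xy \<open>z \<in> X\<close>]
      comparable_if_dominated[OF T conn adm _ \<open>w \<in> X\<close>, of x z]
      comparable_if_dominated[OF T conn admissible_converse[OF T adm] _ \<open>w \<in> X\<close>, of y z]
    by (auto simp: asym_part_converse)
  have "trans RS"
  proof (rule transI, rule ccontr)
    fix a b c assume abc: "(a, b) \<in> RS" "(b, c) \<in> RS" and "(a, c) \<notin> RS"
    \<comment> \<open>Splitting this strict pair at b reverses (b, c) or (a, b) strictly.\<close>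
    then have "(c, a) \<in> asym_part RS" "b \<in> X"
      using comp sub by (auto simp: asym_part_def)
    from asym_part_negatively_transitive[OF T conn adm this] show False
      using abc by (auto simp: asym_part_def)
  qed
  then show ?thesis
    using comp sub by (auto simp: complete_rel_on_def)
qed

text \<open>With an empty symmetric part, all semi-transitivity conditions are vacuous, and every
  section is \<open>A\<close>, \<open>B\<close> or empty, hence clopen.\<close>

lemma separation_imp_admissible:
  assumes T: "topspace T = X"
    and AB: "openin T A" "openin T B" "A \<union> B = X" "A \<inter> B = {}" "A \<noteq> {}" "B \<noteq> {}"
  shows "(A \<times> B, A \<times> B) \<in> admissible_bi_relations X T"
proof -
  have parts: "asym_part (A \<times> B) = A \<times> B" "sym_part (A \<times> B) = {}"
    using AB by (auto simp: asym_part_def sym_part_def)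
  have "X - A = B" "X - B = A"
    using AB by auto
  then have "closedin T A" "closedin T B"
    using AB T by (auto simp: closedin_def)
  moreover have "(A \<times> B) `` {x} = (if x \<in> A then B else {})"
    "(A \<times> B)\<inverse> `` {x} = (if x \<in> B then A else {})" for x
    by auto
  ultimately show ?thesis
    using AB
    by (auto simp: admissible_iff[OF T] parts bi_relation_def nontrivial_bi_relation_def
        semi_transitive_bi_relation_def semi_transitive_def rel_compose_eq)
qed

theorem theorem2:
  fixes X :: "'a set" and T :: "'a topology"
  assumes "topspace T = X"
  shows "(connected_space T \<longleftrightarrow>
            (\<forall>R. R \<subseteq> X \<times> X \<longrightarrow> (R, R) \<in> admissible_bi_relations X T \<longrightarrow>
               complete_rel_on X R \<and> trans R)) \<and>
         ((\<forall>R. R \<subseteq> X \<times> X \<longrightarrow> (R, R) \<in> admissible_bi_relations X T \<longrightarrow>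
               complete_rel_on X R \<and> trans R) \<longleftrightarrow>
            (\<forall>RH RS. bi_relation X RH RS \<longrightarrow> (RH, RS) \<in> admissible_bi_relations X T \<longrightarrow>
               complete_rel_on X RS \<and> trans RS))"
    (is "(?a \<longleftrightarrow> ?b) \<and> (?b \<longleftrightarrow> ?c)")
proof -
  have "?a \<Longrightarrow> ?c"
    using connected_imp_complete_trans[OF assms] by blast
  moreover have "?c \<Longrightarrow> ?b"
    by (auto simp: bi_relation_def)
  moreover have "?a" if b: "?b"
  proof (rule ccontr)
    assume "\<not> ?a"
    then obtain A B where AB: "openin T A" "openin T B" "A \<union> B = X" "A \<inter> B = {}"
        "A \<noteq> {}" "B \<noteq> {}"
      using assms unfolding connected_space_eq by metis
    have "A \<times> B \<subseteq> X \<times> X"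
      using AB by auto
    then have "complete_rel_on X (A \<times> B)"
      using b separation_imp_admissible[OF assms AB] by blast
    \<comment> \<open>Completeness includes the diagonal, but (a, a) is not in
      \<open>A \<times> B\<close>.\<close>
    moreover obtain a where "a \<in> A" "a \<in> X" "a \<notin> B"
      using AB by blast
    ultimately show False
      unfolding complete_rel_on_def by blast
  qed
  ultimately show ?thesis
    by argo
qed

end
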